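(* For every $(\boldsymbol{\alpha}',\boldsymbol{\beta}')\in\Sigma_2^1\times\Sigma_2^0$ there exists $(\boldsymbol{\alpha},\boldsymbol{\beta})\in\mathcal{LW}$ such that $$(\Sigma_{(\boldsymbol{\alpha}',\boldsymbol{\beta}')},\sigma_{(\boldsymbol{\alpha}',\boldsymbol{\beta}')})=(\Sigma_{(\boldsymbol{\alpha},\boldsymbol{\beta})},\sigma_{(\boldsymbol{\alpha},\boldsymbol{\beta})}).$$
   Context: $\mathbb N=\{1,2,\dots\}$, $\Sigma_2=\{0,1\}^{\mathbb N}$ with the product topology, $\sigma$ is the one-sided shift, $\prec,\preccurlyeq$ denote the lexicographic order. $\Sigma_2^1$ (resp. $\Sigma_2^0$) is the set of sequences with first digit $1$ (resp. $0$). For $(\boldsymbol{\alpha},\boldsymbol{\beta})\in\Sigma_2^1\times\Sigma_2^0$, $\Sigma_{(\boldsymbol{\alpha},\boldsymbol{\beta})}=\{\boldsymbol{x}\in\Sigma_2 : \boldsymbol{\beta}\preccurlyeq\sigma^n(\boldsymbol{x})\preccurlyeq\boldsymbol{\alpha}\ \forall n\ge0\}$ and $\sigma_{(\boldsymbol{\alpha},\boldsymbol{\beta})}$ is the restriction of $\sigma$ to it. $P=\{\boldsymbol{\alpha}\in\Sigma_2^1 : \sigma^n(\boldsymbol{\alpha})\preccurlyeq\boldsymbol{\alpha}\ \forall n\in\mathbb N\}$; with $\bar{\boldsymbol{x}}=(1-x_i)_{i\ge1}$, $\bar P=\{\boldsymbol{x}\in\Sigma_2^0:\bar{\boldsymbol{x}}\in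 P\}$. The lexicographic world $\mathcal{LW}$ is the set of pairs $(\boldsymbol{\alpha},\boldsymbol{\beta})\in P\times\bar P$ such that $\sigma^n(\boldsymbol{\alpha})\succcurlyeq\boldsymbol{\beta}$ and $\sigma^n(\boldsymbol{\beta})\preccurlyeq\boldsymbol{\alpha}$ for every $n\in\mathbb N$.
   Formalization: The formal theorem assumes in addition that Σ_(α',β') is nonempty; without this the claim fails, e.g. for α'=10^∞, β'=01^∞ the subshift is empty, while every pair in LW has a nonempty subshift. *)

theory Defs
  imports Main "HOL-Library.FuncSet" "HOL-Library.Fun_Lexorder"
begin

text \<open>
  A sequence \<open>x\<^sub>1 x\<^sub>2 \<dots>\<close> of digits is represented by a function on \<^typ>\<open>nat\<close> whose value at
  \<open>i\<close> is the digit \<open>x\<^sub>i\<^sub>+\<^sub>1\<close>; in particular the first digit of \<open>x\<close> is \<open>x 0\<close>.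
\<close>

type_synonym digits = "nat \<Rightarrow> nat"

definition Sigma2 :: "digits set" where
  "Sigma2 = UNIV \<rightarrow> {0, 1}"

definition Sigma2_first :: "nat \<Rightarrow> digits set" where
  "Sigma2_first d = {x \<in> Sigma2. x 0 = d}"

definition shift :: "digits \<Rightarrow> digits" where
  "shift x = (\<lambda>i. x (Suc i))"

text \<open>
  The strict lexicographic order is \<^const>\<open>less_fun\<close>.
\<close>

definition lexle :: "digits \<Rightarrow> digits \<Rightarrow> bool"  (infix \<open>\<preceq>\<close> 50) where
  "x \<preceq> y \<longleftrightarrow> less_fun x y \<or> x = y"

definition lex_subshift :: "digits \<Rightarrow> digits \<Rightarrow> digits set" where
  "lex_subshift \<alpha> \<beta> = {x \<in> Sigma2. \<forall>n. \<beta> \<preceq> (shift ^^ n) x \<and> (shift ^^ n) x \<preceq> \<alpha>}"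

definition lex_system :: "digits \<Rightarrow> digits \<Rightarrow> digits set \<times> (digits \<Rightarrow> digits)" where
  "lex_system \<alpha> \<beta> = (lex_subshift \<alpha> \<beta>, restrict shift (lex_subshift \<alpha> \<beta>))"

definition Parry :: "digits set" where
  "Parry = {\<alpha> \<in> Sigma2_first 1. \<forall>n\<ge>1. (shift ^^ n) \<alpha> \<preceq> \<alpha>}"

definition mirror :: "digits \<Rightarrow> digits" where
  "mirror x = (\<lambda>i. 1 - x i)"

definition Parry_bar :: "digits set" where
  "Parry_bar = {x \<in> Sigma2_first 0. mirror x \<in> Parry}"

definition LW :: "(digits \<times> digits) set" where
  "LW = {(\<alpha>, \<beta>). \<alpha> \<in> Parry \<and> \<beta> \<in> Parry_bar \<and>
           (\<forall>n\<ge>1. \<beta> \<preceq> (shift ^^ n) \<alpha> \<and> (shift ^^ n) \<beta> \<preceq> \<alpha>)}"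

text \<open>
  Every pair in \<^const>\<open>LW\<close> has a nonempty subshift, whereas for \<open>\<alpha> = 1000\<dots>\<close> and \<open>\<beta> = 0111\<dots>\<close>
  the subshift is empty.  Hence a pair can be replaced by one in \<^const>\<open>LW\<close> with the same
  subshift only under the convention that a dynamical system has a nonempty phase space.
\<close>

lemma LW_nonempty:
  assumes "(\<alpha>, \<beta>) \<in> LW"
  shows "lex_subshift \<alpha> \<beta> \<noteq> {}"
proof -
  have P: "\<alpha> \<in> Parry" and Q: "\<beta> \<in> Parry_bar"
    and R: "\<And>n. n \<ge> 1 \<Longrightarrow> \<beta> \<preceq> (shift ^^ n) \<alpha>"
    using assms by (auto simp: LW_def)
  have a0: "\<alpha> 0 = 1" and b0: "\<beta> 0 = 0" and S: "\<alpha> \<in> Sigma2"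
    and T: "\<And>n. n \<ge> 1 \<Longrightarrow> (shift ^^ n) \<alpha> \<preceq> \<alpha>"
    using P Q by (auto simp: Parry_def Parry_bar_def Sigma2_first_def)
  have "less_fun \<beta> \<alpha>"
    using a0 b0 by (auto simp: less_fun_def intro!: exI[of _ 0])
  then have "\<beta> \<preceq> (shift ^^ n) \<alpha> \<and> (shift ^^ n) \<alpha> \<preceq> \<alpha>" for n
    using R[of n] T[of n] by (cases n) (auto simp: lexle_def)
  then show ?thesis
    using S by (auto simp: lex_subshift_def)
qed

lemma lex_subshift_empty_example:
  defines "\<alpha> \<equiv> (\<lambda>i. if i = 0 then 1 else 0) :: digits"
    and "\<beta> \<equiv> (\<lambda>i. if i = 0 then 0 else 1) :: digits"
  shows "\<alpha> \<in> Sigma2_first 1" "\<beta> \<in> Sigma2_first 0" "lex_subshift \<alpha> \<beta> = {}"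
proof -
  show "\<alpha> \<in> Sigma2_first 1" "\<beta> \<in> Sigma2_first 0"
    by (auto simp: \<alpha>_def \<beta>_def Sigma2_first_def Sigma2_def)
  have False if x: "x \<in> lex_subshift \<alpha> \<beta>" for x
  proof -
    have b: "\<beta> \<preceq> (shift ^^ n) x" and a: "(shift ^^ n) x \<preceq> \<alpha>" for n
      using x by (auto simp: lex_subshift_def)
    have d: "x i = 0 \<or> x i = 1" for i
      using x by (auto simp: lex_subshift_def Sigma2_def Pi_iff)
    show False
    proof (cases "x 0 = 0")
      case True
      have "\<not> less_fun \<beta> x"
      proof
        assume "less_fun \<beta> x"
        then obtain k where "\<beta> k < x k" by (auto simp: less_fun_def)
        then show False using d[of k] True by (auto simp: \<beta>_def split: if_splits)
      qed
      then have e: "shift x = (\<lambda>i. 1)"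
        using b[of 0] by (auto simp: lexle_def shift_def \<beta>_def)
      have "\<not> less_fun (\<lambda>i. 1) \<alpha>" by (auto simp: less_fun_def \<alpha>_def)
      moreover have "(\<lambda>i. 1) \<noteq> \<alpha>"
      proof
        assume "(\<lambda>i. 1) = \<alpha>"
        from fun_cong[OF this, of 1] show False by (simp add: \<alpha>_def)
      qed
      ultimately show False using a[of 1] e by (simp add: lexle_def)
    next
      case False
      have "\<not> less_fun x \<alpha>"
        using False by (auto simp: less_fun_def \<alpha>_def)
      then have e: "shift x = (\<lambda>i. 0)"
        using a[of 0] by (auto simp: lexle_def shift_def \<alpha>_def)
      have "\<not> less_fun \<beta> (\<lambda>i. 0)" by (auto simp: less_fun_def)
      moreover have "(\<lambda>i. 0) \<noteq> \<beta>"
      proof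
        assume "(\<lambda>i. 0) = \<beta>"
        from fun_cong[OF this, of 1] show False by (simp add: \<beta>_def)
      qed
      ultimately show False using b[of 1] e by (auto simp: lexle_def)
    qed
  qed
  then show "lex_subshift \<alpha> \<beta> = {}" by auto
qed

end

theory Submission
  imports Defs
begin

text \<open>
  A nonempty subshift \<open>X\<close> cut out by a pair \<open>(\<alpha>', \<beta>')\<close> is closed, so it has a lexicographically
  greatest element \<open>\<alpha>\<close> and a least element \<open>\<beta>\<close>.  Invariance of \<open>X\<close> under the shift puts
  \<open>(\<alpha>, \<beta>)\<close> in the lexicographic world, and \<open>\<beta>' \<preceq> \<beta>\<close>, \<open>\<alpha> \<preceq> \<alpha>'\<close> make the new pair cut out \<open>X\<close>
  again.  The first digits are right because \<open>X\<close> contains sequences starting with either digit: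
  if \<open>0\<^sup>\<infinity> \<in> X\<close>, then \<open>\<beta>' = 0\<^sup>\<infinity>\<close> and so \<open>10\<^sup>\<infinity> \<in> X\<close>, and symmetrically for \<open>1\<^sup>\<infinity>\<close>.
\<close>

text \<open>Totality of the order: two distinct sequences are decided at the first index where they
  differ.\<close>

lemma not_lexle_iff: "\<not> x \<preceq> y \<longleftrightarrow> less_fun y x"
proof
  assume "\<not> x \<preceq> y"
  then have ne: "x \<noteq> y" and nl: "\<not> less_fun x y"
    by (auto simp: lexle_def)
  from ne have ex: "\<exists>k. x k \<noteq> y k" by auto
  define k where "k = (LEAST k. x k \<noteq> y k)"
  have k: "x k \<noteq> y k" and below: "\<And>j. j < k \<Longrightarrow> x j = y j"
    using LeastI_ex[OF ex] not_less_Least unfolding k_def by blast+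
  have "\<not> x k < y k" using nl below by (auto simp: less_fun_def)
  then have "y k < x k" using k by simp
  then show "less_fun y x" using below by (auto simp: less_fun_def)
next
  assume "less_fun y x"
  then show "\<not> x \<preceq> y"
    using less_fun_asym[of y x] by (auto simp: lexle_def less_fun_irrefl)
qed

lemma lexle_trans: "x \<preceq> y \<Longrightarrow> y \<preceq> z \<Longrightarrow> x \<preceq> z"
  by (auto simp: lexle_def intro: less_fun_trans)

lemma lexle_pointwise: "(\<And>i. x i \<le> y i) \<Longrightarrow> x \<preceq> y"
  by (rule ccontr) (auto simp: not_lexle_iff less_fun_def not_less[symmetric])

lemma lexle_first: "x \<preceq> y \<Longrightarrow> x 0 \<le> y 0"
  by (auto simp: lexle_def less_fun_def) (metis gr0I less_imp_le_nat order_refl)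

lemma shift_funpow: "(shift ^^ n) x = (\<lambda>i. x (n + i))"
  by (induction n) (auto simp: shift_def)

lemma Sigma2_digit: "x \<in> Sigma2 \<Longrightarrow> x i = 0 \<or> x i = 1"
  by (auto simp: Sigma2_def Pi_iff)

lemma Sigma2_shift: "x \<in> Sigma2 \<Longrightarrow> (shift ^^ n) x \<in> Sigma2"
  by (simp add: Sigma2_def shift_funpow Pi_iff)

lemma Sigma2_mirror: "mirror x \<in> Sigma2"
  by (auto simp: Sigma2_def mirror_def)

lemma mirror_mirror:
  assumes "x \<in> Sigma2" shows "mirror (mirror x) = x"
proof
  show "mirror (mirror x) i = x i" for i
    using Sigma2_digit[OF assms, of i] by (auto simp: mirror_def)
qed

lemma shift_mirror: "(shift ^^ n) (mirror x) = mirror ((shift ^^ n) x)"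
  by (simp add: shift_funpow mirror_def)

text \<open>Exchanging 0 and 1 reverses each digit comparison and leaves the first differing index
  in place.\<close>

lemma lexle_mirror:
  assumes "x \<in> Sigma2" "y \<in> Sigma2"
  shows "mirror x \<preceq> mirror y \<longleftrightarrow> y \<preceq> x"
proof -
  have "less_fun (mirror y) (mirror x) \<longleftrightarrow> less_fun x y"
  proof -
    have "mirror y k < mirror x k \<longleftrightarrow> x k < y k" "mirror y k = mirror x k \<longleftrightarrow> x k = y k" for k
      using Sigma2_digit[OF assms(1), of k] Sigma2_digit[OF assms(2), of k]
      by (auto simp: mirror_def)
    then show ?thesis by (simp add: less_fun_def)
  qed
  then show ?thesis using not_lexle_iff by blast
qed

lemma lex_subshift_shift:
  "x \<in> lex_subshift \<alpha> \<beta> \<Longrightarrow> (shift ^^ n) x \<in> lex_subshift \<alpha> \<beta>"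
  by (simp add: lex_subshift_def Sigma2_def Pi_iff shift_funpow flip: add.assoc)

lemma lex_subshift_bounds:
  assumes "x \<in> lex_subshift \<alpha> \<beta>" shows "\<beta> \<preceq> x" "x \<preceq> \<alpha>"
proof -
  have "\<beta> \<preceq> (shift ^^ 0) x \<and> (shift ^^ 0) x \<preceq> \<alpha>"
    using assms unfolding lex_subshift_def by blast
  then show "\<beta> \<preceq> x" "x \<preceq> \<alpha>" by simp_all
qed

lemma lex_subshift_mirror:
  assumes "\<alpha> \<in> Sigma2" "\<beta> \<in> Sigma2" "x \<in> Sigma2"
  shows "mirror x \<in> lex_subshift (mirror \<beta>) (mirror \<alpha>) \<longleftrightarrow> x \<in> lex_subshift \<alpha> \<beta>"
  using assms by (auto simp: lex_subshift_def Sigma2_mirror shift_mirror lexle_mirror Sigma2_shift)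

text \<open>A failure of either bound at some shift shows in finitely many digits, so a member of
  the subshift agreeing with \<open>s\<close> that far would fail too.\<close>

lemma lex_subshift_closed:
  assumes approx: "\<And>n. \<exists>y \<in> lex_subshift \<alpha> \<beta>. \<forall>i<n. y i = s i"
  shows "s \<in> lex_subshift \<alpha> \<beta>"
proof -
  have "s i \<in> {0, 1}" for i
    using approx[of "Suc i"] by (auto simp: lex_subshift_def dest: Sigma2_digit[of _ i])
  moreover have "\<beta> \<preceq> (shift ^^ n) s" for n
  proof (rule ccontr)
    assume "\<not> \<beta> \<preceq> (shift ^^ n) s"
    then obtain k where k: "s (n + k) < \<beta> k" "\<forall>j<k. s (n + j) = \<beta> j"
      by (auto simp: not_lexle_iff less_fun_def shift_funpow)
    \<comment> \<open>The length \<open>Suc (n + k)\<close> just reaches the deciding digit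
      \<open>s (n + k)\<close>.\<close>
    obtain y where y: "y \<in> lex_subshift \<alpha> \<beta>" "\<forall>i<Suc (n + k). y i = s i"
      using approx by blast
    have "less_fun ((shift ^^ n) y) \<beta>"
      using k y(2) by (auto simp: less_fun_def shift_funpow intro!: exI[of _ k])
    then show False
      using lex_subshift_bounds(1)[OF lex_subshift_shift[OF y(1)]] not_lexle_iff by blast
  qed
  moreover have "(shift ^^ n) s \<preceq> \<alpha>" for n
  proof (rule ccontr)
    assume "\<not> (shift ^^ n) s \<preceq> \<alpha>"
    then obtain k where k: "\<alpha> k < s (n + k)" "\<forall>j<k. \<alpha> j = s (n + j)"
      by (auto simp: not_lexle_iff less_fun_def shift_funpow)
    obtain y where y: "y \<in> lex_subshift \<alpha> \<beta>" "\<forall>i<Suc (n + k). y i = s i"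
      using approx by blast
    have "less_fun \<alpha> ((shift ^^ n) y)"
      using k y(2) by (auto simp: less_fun_def shift_funpow intro!: exI[of _ k])
    then show False
      using lex_subshift_bounds(2)[OF lex_subshift_shift[OF y(1)]] not_lexle_iff by blast
  qed
  ultimately show ?thesis by (auto simp: lex_subshift_def Sigma2_def)
qed

text \<open>The supremum is built greedily, digit by digit. It is only a limit of members of
  \<open>X\<close>; that it belongs to \<open>X\<close> needs closedness.\<close>

lemma lex_limit_upper_bound:
  assumes X: "X \<subseteq> Sigma2" "X \<noteq> {}"
  shows "\<exists>s. (\<forall>x\<in>X. x \<preceq> s) \<and> (\<forall>n. \<exists>y\<in>X. \<forall>i<n. y i = s i)"
proof -
  \<comment> \<open>\<open>y\<close> is greatest in \<open>X\<close> as far as the first \<open>n\<close> digits can tell.\<close>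
  define P where "P n y \<longleftrightarrow> y \<in> X \<and> (\<forall>x\<in>X. \<forall>k<n. (\<forall>j<k. y j = x j) \<longrightarrow> x k \<le> y k)"
    for n and y :: digits
  have "\<exists>f. \<forall>n. P n (f n) \<and> (\<forall>i<n. f (Suc n) i = f n i)"
  proof (rule dependent_nat_choice)
    show "\<exists>y. P 0 y" using X(2) by (auto simp: P_def)
  next
    fix y n assume y: "P n y"
    \<comment> \<open>Digit \<open>n\<close> becomes 1 if some member of \<open>X\<close> continues
      the prefix of \<open>y\<close> that way; otherwise all such continuations have 0 there and
      \<open>y\<close> itself can be kept.\<close>
    show "\<exists>z. P (Suc n) z \<and> (\<forall>i<n. z i = y i)"
    proof (cases "\<exists>z\<in>X. (\<forall>i<n. z i = y i) \<and> z n = 1")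
      case True
      then obtain z where z: "z \<in> X" "\<forall>i<n. z i = y i" "z n = 1" by blast
      have "x n \<le> z n" if "x \<in> X" for x
        using that X(1) z(3) Sigma2_digit[of x n] by force
      then have "P (Suc n) z"
        using y z by (auto simp: P_def less_Suc_eq)
      with z show ?thesis by blast
    next
      case False
      have "x n \<le> y n" if "x \<in> X" "\<forall>j<n. y j = x j" for x
      proof -
        have "x n \<noteq> 1" using False that by auto
        then show ?thesis using that(1) X(1) Sigma2_digit[of x n] by auto
      qed
      then have "P (Suc n) y"
        using y by (auto simp: P_def less_Suc_eq)
      then show ?thesis by blast
    qed
  qed
  then obtain f where f: "\<And>n. P n (f n)" and step: "\<And>n i. i < n \<Longrightarrow> f (Suc n) i = f n i"
    by blast
  \<comment> \<open>Digit \<open>i\<close> is settled from \<open>f (Suc i)\<close> onwards, since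
    later choices preserve it.\<close>
  define s where "s i = f (Suc i) i" for i
  have agree: "f n i = s i" if "i < n" for i n
    using that
  proof (induction n)
    case (Suc n)
    then show ?case by (cases "i = n") (auto simp: s_def step)
  qed simp
  have "x \<preceq> s" if "x \<in> X" for x
  proof (rule ccontr)
    assume "\<not> x \<preceq> s"
    then obtain k where "s k < x k" "\<forall>j<k. s j = x j"
      by (auto simp: not_lexle_iff less_fun_def)
    then show False
      using f[of "Suc k"] that agree[of _ "Suc k"] by (fastforce simp: P_def)
  qed
  moreover have "\<exists>y\<in>X. \<forall>i<n. y i = s i" for n
    using f[of n] agree by (auto simp: P_def)
  ultimately show ?thesis by blast
qed

lemma lex_subshift_has_first_1:
  assumes \<alpha>: "\<alpha> \<in> Sigma2_first 1" and ne: "lex_subshift \<alpha> \<beta> \<noteq> {}"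
  shows "\<exists>x \<in> lex_subshift \<alpha> \<beta>. x 0 = 1"
proof -
  obtain x where x: "x \<in> lex_subshift \<alpha> \<beta>" using ne by blast
  show ?thesis
  proof (cases "\<exists>i. x i = 1")
    case True
    then obtain i where "x i = 1" ..
    then show ?thesis
      using lex_subshift_shift[OF x, of i] by (intro bexI) (auto simp: shift_funpow)
  next
    case False
    then have "x = (\<lambda>i. 0)"
      using x Sigma2_digit by (fastforce simp: lex_subshift_def)
    then have "\<beta> \<preceq> (\<lambda>i. 0)" using lex_subshift_bounds(1)[OF x] by simp
    then have \<beta>: "\<beta> = (\<lambda>i. 0)" by (auto simp: lexle_def less_fun_def)
    \<comment> \<open>The least sequence starting with 1: it and its shifts are digitwise below
      \<alpha>, and the lower bound is automatic because \<beta> vanishes.\<close>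
    define y :: digits where "y i = (if i = 0 then 1 else 0)" for i
    have "y \<in> Sigma2" by (auto simp: y_def Sigma2_def)
    moreover have "\<beta> \<preceq> (shift ^^ n) y" for n
      by (rule lexle_pointwise) (simp add: \<beta>)
    moreover have "(shift ^^ n) y \<preceq> \<alpha>" for n
      using \<alpha> by (intro lexle_pointwise) (auto simp: Sigma2_first_def y_def shift_funpow)
    ultimately have "y \<in> lex_subshift \<alpha> \<beta>" by (simp add: lex_subshift_def)
    then show ?thesis by (intro bexI) (auto simp: y_def)
  qed
qed

text \<open>Closedness turns the greedy supremum into a maximum, and a member starting with 1 forces
  its first digit.\<close>

lemma lex_subshift_greatest:
  assumes \<alpha>: "\<alpha> \<in> Sigma2_first 1" and ne: "lex_subshift \<alpha> \<beta> \<noteq> {}"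
  shows "\<exists>m \<in> lex_subshift \<alpha> \<beta>. m 0 = 1 \<and> (\<forall>x \<in> lex_subshift \<alpha> \<beta>. x \<preceq> m)"
proof -
  have "lex_subshift \<alpha> \<beta> \<subseteq> Sigma2" by (auto simp: lex_subshift_def)
  from lex_limit_upper_bound[OF this ne] obtain m
    where ub: "\<forall>x \<in> lex_subshift \<alpha> \<beta>. x \<preceq> m" and m: "m \<in> lex_subshift \<alpha> \<beta>"
    using lex_subshift_closed by blast
  obtain x where "x \<in> lex_subshift \<alpha> \<beta>" "x 0 = 1"
    using lex_subshift_has_first_1[OF assms] by blast
  then have "1 \<le> m 0" using ub lexle_first[of x m] by auto
  then have "m 0 = 1"
    using m Sigma2_digit[of m 0] by (auto simp: lex_subshift_def)
  with ub m show ?thesis by blast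
qed

text \<open>Dual of the greatest element: \<open>mirror\<close> reverses the order and swaps the two
  bounds, so the mirrored maximum of \<open>?Y\<close> is the minimum.\<close>

lemma lex_subshift_least:
  assumes \<alpha>: "\<alpha> \<in> Sigma2" and \<beta>: "\<beta> \<in> Sigma2_first 0" and ne: "lex_subshift \<alpha> \<beta> \<noteq> {}"
  shows "\<exists>m \<in> lex_subshift \<alpha> \<beta>. m 0 = 0 \<and> (\<forall>x \<in> lex_subshift \<alpha> \<beta>. m \<preceq> x)"
proof -
  let ?Y = "lex_subshift (mirror \<beta>) (mirror \<alpha>)"
  have S: "\<beta> \<in> Sigma2" using \<beta> by (simp add: Sigma2_first_def)
  have X: "x \<in> Sigma2" "mirror x \<in> ?Y" if "x \<in> lex_subshift \<alpha> \<beta>" for x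
    using that lex_subshift_mirror[OF \<alpha> S] by (auto simp: lex_subshift_def)
  have "mirror \<beta> \<in> Sigma2_first 1"
    using \<beta> Sigma2_mirror by (auto simp: Sigma2_first_def mirror_def)
  moreover have "?Y \<noteq> {}" using ne X by blast
  ultimately obtain m where m: "m \<in> ?Y" "m 0 = 1" and ub: "\<forall>x\<in>?Y. x \<preceq> m"
    using lex_subshift_greatest by blast
  have mm: "mirror (mirror m) = m"
    using m(1) by (intro mirror_mirror) (auto simp: lex_subshift_def)
  have "mirror m \<in> lex_subshift \<alpha> \<beta>"
    using lex_subshift_mirror[OF \<alpha> S Sigma2_mirror, of m] m(1) mm by simp
  moreover have "mirror m \<preceq> x" if "x \<in> lex_subshift \<alpha> \<beta>" for x
    using ub X[OF that] lexle_mirror[OF _ Sigma2_mirror, of x m] mm by auto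
  moreover have "mirror m 0 = 0" using m(2) by (simp add: mirror_def)
  ultimately show ?thesis by blast
qed

theorem theorem3p20:
  fixes \<alpha>' \<beta>' :: digits
  assumes "\<alpha>' \<in> Sigma2_first 1" and "\<beta>' \<in> Sigma2_first 0"
    and nonempty: "lex_subshift \<alpha>' \<beta>' \<noteq> {}"
  shows "\<exists>(\<alpha>, \<beta>) \<in> LW. lex_system \<alpha>' \<beta>' = lex_system \<alpha> \<beta>"
proof -
  let ?X = "lex_subshift \<alpha>' \<beta>'"
  obtain \<alpha> where \<alpha>: "\<alpha> \<in> ?X" "\<alpha> 0 = 1" "\<And>x. x \<in> ?X \<Longrightarrow> x \<preceq> \<alpha>"
    using lex_subshift_greatest[OF assms(1) nonempty] by blast
  obtain \<beta> where \<beta>: "\<beta> \<in> ?X" "\<beta> 0 = 0" "\<And>x. x \<in> ?X \<Longrightarrow> \<beta> \<preceq> x"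
    using lex_subshift_least[OF _ assms(2) nonempty] assms(1) by (auto simp: Sigma2_first_def)
  have S: "\<alpha> \<in> Sigma2" "\<beta> \<in> Sigma2" using \<alpha>(1) \<beta>(1) by (auto simp: lex_subshift_def)
  have "\<alpha> \<in> Parry"
    using \<alpha> S lex_subshift_shift by (auto simp: Parry_def Sigma2_first_def)
  \<comment> \<open>Shifts of \<beta> stay in \<open>?X\<close>, hence above \<beta>; mirroring
    turns this into the Parry condition.\<close>
  moreover have "mirror \<beta> \<in> Parry"
    using \<beta> S lex_subshift_shift
    by (auto simp: Parry_def Sigma2_first_def Sigma2_mirror shift_mirror lexle_mirror Sigma2_shift)
      (simp add: mirror_def)
  ultimately have "(\<alpha>, \<beta>) \<in> LW"
    using \<alpha> \<beta> S lex_subshift_shift by (auto simp: LW_def Parry_bar_def Sigma2_first_def)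
  moreover have "?X = lex_subshift \<alpha> \<beta>"
  proof
    show "?X \<subseteq> lex_subshift \<alpha> \<beta>"
    proof
      fix x assume x: "x \<in> ?X"
      then have "x \<in> Sigma2" by (simp add: lex_subshift_def)
      then show "x \<in> lex_subshift \<alpha> \<beta>"
        using \<alpha>(3) \<beta>(3) lex_subshift_shift[OF x] by (simp add: lex_subshift_def)
    qed
    \<comment> \<open>Both extremes lie in \<open>?X\<close>, hence between the old bounds, so the
      new constraints imply the old ones.\<close>
    show "lex_subshift \<alpha> \<beta> \<subseteq> ?X"
      using lex_subshift_bounds(1)[OF \<beta>(1)] lex_subshift_bounds(2)[OF \<alpha>(1)] lexle_trans
      unfolding lex_subshift_def by blast
  qed
  ultimately show ?thesis by (auto simp: lex_system_def)
qed

end
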